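(* Assume the Continuum Hypothesis. Let $\preceq$ be a total ordering on $\mathcal{O}:=(0,1)$ for which there exists an increasing $\mathcal{O}$-family $(A_t)_{t\in\mathcal{O}}$ of Borel subsets of $(0,1)$, with $\bigcup_{t\in(0,1)}A_t$ Borel, such that $$\mathrm{Leb}\left(\bigcup_{t\in(0,1)} A_t\right) > \sup_{t\in(0,1)}\mathrm{Leb}(A_t).$$ Let $(m_t)_{t\in\mathcal{O}}$ be a non-decreasing family of non-negative real numbers (that is, $m_s\le m_t$ whenever $s\preceq t$), and let $M$ be a real number with $M\ge\sup_{t\in\mathcal{O}}m_t$. Then there exists an increasing $\mathcal{O}$-family $(B_t)_{t\in\mathcal{O}}$ of Borel subsets of $(0,M)$ (with $\bigcup_{t\in(0,1)}B_t$ Borel) such that $$\mathrm{Leb}(B_t)=m_t\text{ for all }t\in(0,1),\quad\text{and}\quad \mathrm{Leb}\left(\bigcup_{t\in(0,1)}B_t\right)=M.$$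
   Context: $\mathrm{Leb}$ denotes Lebesgue measure on Borel subsets of $\mathbb{R}$. The ordering $\preceq$ on $(0,1)$ need not be the standard one. Given a totally ordered index set $(\mathcal{O},\preceq)$, an increasing $\mathcal{O}$-family of Borel sets is a collection $(A_t)_{t\in\mathcal{O}}$ of Borel sets such that $A_s\subseteq A_t$ whenever $s\preceq t$. The Continuum Hypothesis is the statement that for every uncountably infinite set $S$ there exists an injection $g\colon\mathbb{R}\to S$; equivalently, $|\mathbb{R}|=\aleph_1$. The interval $(0,M)$ is empty if $M=0$. *)

theory Defs
  imports "HOL-Analysis.Analysis"
begin

unbundle cardinal_syntax

text \<open>
  The Continuum Hypothesis, as \<open>|\<real>| = \<aleph>\<^sub>1\<close>. The formulation ``\<open>\<real>\<close> injects into every uncountable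
  set'' quantifies over sets of all types, so it cannot serve as a definition; the two lemmas below
  recover it: it follows for sets over any type, and its instance for sets of reals is already
  sufficient.
\<close>

definition Continuum_Hypothesis :: bool where
  "Continuum_Hypothesis \<longleftrightarrow> |UNIV :: real set| =o cardSuc natLeq"

lemma uncountable_iff_cardSuc_natLeq: "uncountable S \<longleftrightarrow> cardSuc natLeq \<le>o |S|"
proof -
  have "countable S \<longleftrightarrow> |S| \<le>o natLeq"
    unfolding countable_def card_of_ordLeq[symmetric]
    using card_of_nat ordIso_iff_ordLeq ordLeq_transitive
    by (metis card_of_ordLeq subset_UNIV)
  also have "\<dots> \<longleftrightarrow> \<not> natLeq <o |S|"
    using not_ordLess_iff_ordLeq[OF card_of_Well_order natLeq_Well_order] by blast
  finally show ?thesis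
    using cardSuc_ordLess_ordLeq[OF natLeq_Card_order card_of_Card_order] by blast
qed

lemma Continuum_Hypothesis_injection:
  fixes S :: "'a set"
  assumes "Continuum_Hypothesis" "uncountable S"
  shows "\<exists>g :: real \<Rightarrow> 'a. inj g \<and> range g \<subseteq> S"
proof -
  have "|UNIV :: real set| \<le>o |S|"
    using assms ordIso_ordLeq_trans
    unfolding Continuum_Hypothesis_def uncountable_iff_cardSuc_natLeq by blast
  then show ?thesis
    by (simp add: card_of_ordLeq[symmetric])
qed

lemma Continuum_Hypothesis_iff_injection:
  "Continuum_Hypothesis \<longleftrightarrow>
    (\<forall>S :: real set. uncountable S \<longrightarrow> (\<exists>g :: real \<Rightarrow> real. inj g \<and> range g \<subseteq> S))"
proof
  assume H: "\<forall>S :: real set. uncountable S \<longrightarrow> (\<exists>g :: real \<Rightarrow> real. inj g \<and> range g \<subseteq> S)"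
  have le: "cardSuc natLeq \<le>o |UNIV :: real set|"
    using uncountable_UNIV_real by (simp add: uncountable_iff_cardSuc_natLeq)
  have iso: "|Field (cardSuc natLeq)| =o cardSuc natLeq"
    by (simp add: card_of_Field_ordIso cardSuc_Card_order natLeq_Card_order)
  have "|Field (cardSuc natLeq)| \<le>o |UNIV :: real set|"
    using iso le by (rule ordIso_ordLeq_trans)
  then obtain f :: "nat set \<Rightarrow> real" where f: "inj_on f (Field (cardSuc natLeq))"
    using card_of_ordLeq[of "Field (cardSuc natLeq)" "UNIV :: real set"] by blast
  define S where "S = f ` Field (cardSuc natLeq)"
  have S: "|S| =o cardSuc natLeq"
    using f iso unfolding S_def
    by (metis bij_betw_imageI card_of_ordIsoI ordIso_symmetric ordIso_transitive)
  then have S_unc: "uncountable S"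
    by (simp add: uncountable_iff_cardSuc_natLeq ordIso_iff_ordLeq)
  have "|UNIV :: real set| \<le>o |S|"
    using H S_unc card_of_ordLeq[of "UNIV :: real set" S] by blast
  then have "|UNIV :: real set| \<le>o cardSuc natLeq"
    using S by (rule ordLeq_ordIso_trans)
  with le show Continuum_Hypothesis
    by (simp add: Continuum_Hypothesis_def ordIso_iff_ordLeq)
qed (use Continuum_Hypothesis_injection in blast)

definition increasing_borel_family :: "'i set \<Rightarrow> 'i rel \<Rightarrow> ('i \<Rightarrow> real set) \<Rightarrow> bool" where
  "increasing_borel_family I r A \<longleftrightarrow>
    (\<forall>t\<in>I. A t \<in> sets borel) \<and> monotone_on I (\<lambda>s t. (s, t) \<in> r) (\<subseteq>) A"

end

theory Submission
  imports Defs
begin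

text \<open>
  The jump in measure of the given family rules out a countable cofinal set of indices: along such a
  set, continuity from below would make the measure of the union equal to the supremum
  (\<open>countable_strict_upper_bound\<close>). So every countable set of indices has a strict upper bound.

  The sets \<open>{0<..<m t}\<close> already have the prescribed measures, and adding a countable set to each does
  not change that. It therefore suffices to exhaust \<open>{0<..<M}\<close> by an increasing family of countable
  sets \<open>N t\<close>. For \<open>M > 0\<close> such an exhaustion is uncountable in length, and this is where the Continuum
  Hypothesis is used. It well-orders the reals so that all proper initial segments are countable.
  Attach to each real \<open>x\<close> an index \<open>g x\<close> strictly above all indices that come no later than \<open>x\<close> in
  the well-order, and let \<open>x\<close> enter at index \<open>g x\<close>. Everything that has entered by index \<open>t\<close>
  precedes \<open>t\<close> in the well-order, so only countably many points have
  (\<open>Continuum_Hypothesis_countable_below\<close>), while every point enters eventually.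
\<close>

text \<open>
  Continuity from below for a countable chain of arbitrary order type. Partial unions along an
  enumeration form an increasing sequence, and being finite unions in a chain they are themselves
  members of it.
\<close>

lemma emeasure_UN_countable_chain_le:
  assumes "countable C" "C \<noteq> {}"
    and meas: "\<And>c. c \<in> C \<Longrightarrow> A c \<in> sets M"
    and chain: "\<And>c d. c \<in> C \<Longrightarrow> d \<in> C \<Longrightarrow> A c \<subseteq> A d \<or> A d \<subseteq> A c"
  shows "emeasure M (\<Union>c\<in>C. A c) \<le> (SUP c\<in>C. emeasure M (A c))"
proof -
  obtain e :: "nat \<Rightarrow> 'a" where e: "range e = C"
    using assms(1,2) by (metis uncountable_def)
  define D where "D n = (\<Union>i\<le>n. A (e i))" for n
  have D_in: "\<exists>i. D n = A (e i)" for n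
  proof (induction n)
    case 0
    then show ?case by (auto simp: D_def)
  next
    case (Suc n)
    then obtain i where "D n = A (e i)" by blast
    then have "D (Suc n) = A (e i) \<union> A (e (Suc n))"
      by (auto simp: D_def atMost_Suc)
    then show ?case
      using chain[of "e i" "e (Suc n)"] e by (metis rangeI sup_absorb1 sup_absorb2)
  qed
  have "(SUP n. emeasure M (D n)) = emeasure M (\<Union>n. D n)"
  proof (rule SUP_emeasure_incseq)
    show "range D \<subseteq> sets M"
      using D_in meas e by (metis image_subsetI rangeI)
    show "incseq D"
      unfolding D_def incseq_def by (intro allI impI UN_mono) auto
  qed
  moreover have "(\<Union>n. D n) = (\<Union>c\<in>C. A c)"
    using e by (auto simp: D_def)
  moreover have "emeasure M (D n) \<le> (SUP c\<in>C. emeasure M (A c))" for n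
    using D_in[of n] e by (auto intro!: SUP_upper)
  ultimately show ?thesis
    using SUP_least[of UNIV "\<lambda>n. emeasure M (D n)"] by metis
qed

text \<open>
  In a linear order, a countable set without a strict upper bound is cofinal, so the whole family has
  the same union as a countable subfamily, and there the measure cannot jump. That \<open>u\<close> lies strictly
  above \<open>c\<close> is expressed as \<open>(u, c) \<notin> r\<close>.
\<close>

lemma countable_strict_upper_bound:
  assumes lin: "linear_order_on I r" and A: "increasing_borel_family I r A"
    and jump: "(SUP t\<in>I. emeasure lborel (A t)) < emeasure lborel (\<Union>t\<in>I. A t)"
    and C: "countable C" "C \<subseteq> I"
  shows "\<exists>u\<in>I. \<forall>c\<in>C. (u, c) \<notin> r"
proof (rule ccontr)
  assume "\<not> ?thesis"
  then have cofinal: "\<forall>t\<in>I. \<exists>c\<in>C. (t, c) \<in> r" by blast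
  have "I \<noteq> {}" using jump by auto
  then have "C \<noteq> {}" using cofinal by blast
  have mono: "A s \<subseteq> A t" if "s \<in> I" "t \<in> I" "(s, t) \<in> r" for s t
    using A that unfolding increasing_borel_family_def monotone_on_def by blast
  have total: "(c, d) \<in> r \<or> (d, c) \<in> r \<or> c = d" if "c \<in> I" "d \<in> I" for c d
    using lin that unfolding linear_order_on_def total_on_def by blast
  have "(\<Union>t\<in>I. A t) = (\<Union>c\<in>C. A c)"
    using cofinal mono C(2) by blast
  also have "emeasure lborel \<dots> \<le> (SUP c\<in>C. emeasure lborel (A c))"
  proof (rule emeasure_UN_countable_chain_le[OF C(1) \<open>C \<noteq> {}\<close>])
    show "A c \<in> sets lborel" if "c \<in> C" for c
      using A C(2) that by (auto simp: increasing_borel_family_def)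
    show "A c \<subseteq> A d \<or> A d \<subseteq> A c" if "c \<in> C" "d \<in> C" for c d
      using total[of c d] mono that C(2) by blast
  qed
  also have "\<dots> \<le> (SUP t\<in>I. emeasure lborel (A t))"
    using C(2) by (rule SUP_subset_mono) simp
  finally show False using jump by simp
qed

text \<open>
  The cardinal \<open>|UNIV :: real set|\<close> is itself a well-order of the reals, of least possible length, so
  its proper initial segments have smaller cardinality; below \<open>\<aleph>\<^sub>1\<close> this means countable.
\<close>

lemma Continuum_Hypothesis_countable_underS:
  assumes Continuum_Hypothesis
  shows "countable (underS |UNIV :: real set| x)"
proof -
  have "|underS |UNIV :: real set| x| <o |UNIV :: real set|"
    using card_of_underS[OF card_of_Card_order[of "UNIV :: real set"], of x]
    by (simp add: Field_card_of)
  moreover have "|UNIV :: real set| =o cardSuc natLeq"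
    using assms by (simp add: Continuum_Hypothesis_def)
  ultimately have "|underS |UNIV :: real set| x| <o cardSuc natLeq"
    by (rule ordLess_ordIso_trans)
  then have "\<not> cardSuc natLeq \<le>o |underS |UNIV :: real set| x|"
    by (rule not_ordLess_ordLeq)
  then show ?thesis
    using uncountable_iff_cardSuc_natLeq by blast
qed

text \<open>
  A diagonal choice takes the place of a cofinal \<open>\<omega>\<^sub>1\<close>-sequence in \<open>I\<close>: indices and points to be
  assigned are both reals, so one well-order can compare them. If \<open>g x\<close> is chosen strictly above every
  index up to and including \<open>x\<close>, then \<open>g x\<close> can be at most \<open>t\<close> only when \<open>x\<close> comes before \<open>t\<close>.
\<close>

lemma Continuum_Hypothesis_countable_below:
  fixes r :: "real rel"
  assumes CH: Continuum_Hypothesis and lin: "linear_order_on I r"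
    and bound: "\<And>C. countable C \<Longrightarrow> C \<subseteq> I \<Longrightarrow> \<exists>u\<in>I. \<forall>c\<in>C. (u, c) \<notin> r"
  obtains g :: "real \<Rightarrow> real"
  where "range g \<subseteq> I" and "\<And>t. t \<in> I \<Longrightarrow> countable {x. (g x, t) \<in> r}"
proof -
  let ?W = "|UNIV :: real set|"
  have "\<exists>u\<in>I. \<forall>y\<in>I. y \<in> insert x (underS ?W x) \<longrightarrow> (u, y) \<notin> r" for x
    using bound[of "insert x (underS ?W x) \<inter> I"] Continuum_Hypothesis_countable_underS[OF CH, of x]
    by auto
  then obtain g where g: "\<And>x. g x \<in> I"
    "\<And>x y. y \<in> I \<Longrightarrow> y \<in> insert x (underS ?W x) \<Longrightarrow> (g x, y) \<notin> r"
    by metis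
  have W: "x = y \<or> x \<in> underS ?W y \<or> y \<in> underS ?W x" for x y
    using card_of_well_order_on[of "UNIV :: real set"]
    unfolding well_order_on_def linear_order_on_def total_on_def underS_def by blast
  show ?thesis
  proof
    show "range g \<subseteq> I" using g(1) by blast
    show "countable {x. (g x, t) \<in> r}" if "t \<in> I" for t
    proof (rule countable_subset)
      show "{x. (g x, t) \<in> r} \<subseteq> underS ?W t"
        using g(2)[OF that] W by blast
    qed (rule Continuum_Hypothesis_countable_underS[OF CH])
  qed
qed

theorem corollary5:
  fixes r :: "real rel" and m :: "real \<Rightarrow> real" and M :: real
  assumes "Continuum_Hypothesis"
    and "linear_order_on {0<..<1} r"
    and "\<exists>A. increasing_borel_family {0<..<1} r A
          \<and> (\<forall>t\<in>{0<..<1}. A t \<subseteq> {0<..<1})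
          \<and> (\<Union>t\<in>{0<..<1}. A t) \<in> sets borel
          \<and> emeasure lborel (\<Union>t\<in>{0<..<1}. A t) > (SUP t\<in>{0<..<1}. emeasure lborel (A t))"
    and "\<forall>t\<in>{0<..<1}. 0 \<le> m t"
    and "monotone_on {0<..<1} (\<lambda>s t. (s, t) \<in> r) (\<le>) m"
    and "ereal M \<ge> (SUP t\<in>{0<..<1}. ereal (m t))"
  shows "\<exists>B. increasing_borel_family {0<..<1} r B
          \<and> (\<forall>t\<in>{0<..<1}. B t \<subseteq> {0<..<M})
          \<and> (\<Union>t\<in>{0<..<1}. B t) \<in> sets borel
          \<and> (\<forall>t\<in>{0<..<1}. emeasure lborel (B t) = ennreal (m t))
          \<and> emeasure lborel (\<Union>t\<in>{0<..<1}. B t) = ennreal M"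
proof -
  let ?I = "{0<..<1} :: real set"
  obtain A where A: "increasing_borel_family ?I r A"
    "(SUP t\<in>?I. emeasure lborel (A t)) < emeasure lborel (\<Union>t\<in>?I. A t)"
    using assms(3) by blast
  have bound: "\<exists>u\<in>?I. \<forall>c\<in>C. (u, c) \<notin> r" if "countable C" "C \<subseteq> ?I" for C
    using countable_strict_upper_bound[OF assms(2) A that] .
  obtain g :: "real \<Rightarrow> real" where g_in: "range g \<subseteq> ?I"
    and g_below: "\<And>t. t \<in> ?I \<Longrightarrow> countable {x. (g x, t) \<in> r}"
    using Continuum_Hypothesis_countable_below[OF assms(1,2) bound] by metis
  have m_nonneg: "0 \<le> m t" if "t \<in> ?I" for t using assms(4) that by blast
  have m_le_M: "m t \<le> M" if "t \<in> ?I" for t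
    using assms(6) that by (simp add: SUP_le_iff)
  have M_nonneg: "0 \<le> M"
    using m_nonneg[of "1/2"] m_le_M[of "1/2"] by simp
  have trans: "trans r" and refl: "\<And>t. t \<in> ?I \<Longrightarrow> (t, t) \<in> r"
    using assms(2) unfolding linear_order_on_def partial_order_on_def preorder_on_def refl_on_def
    by blast+
  define N where "N t = {x \<in> {0<..<M}. (g x, t) \<in> r}" for t
  define B where "B t = {0<..<m t} \<union> N t" for t
  have N_countable: "countable (N t)" if "t \<in> ?I" for t
    using g_below[OF that] by (rule countable_subset[rotated]) (auto simp: N_def)
  have N_null: "N t \<in> null_sets lborel" if "t \<in> ?I" for t
    using N_countable[OF that] by (rule countable_imp_null_set_lborel)
  have B_subset: "B t \<subseteq> {0<..<M}" if "t \<in> ?I" for t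
    using m_le_M[OF that] by (auto simp: B_def N_def)
  have B_Un: "(\<Union>t\<in>?I. B t) = {0<..<M}"
  proof
    show "{0<..<M} \<subseteq> (\<Union>t\<in>?I. B t)"
    proof
      fix x assume "x \<in> {0<..<M}"
      moreover have "g x \<in> ?I" using g_in by blast
      ultimately have "x \<in> B (g x)"
        using refl[of "g x"] by (simp add: B_def N_def)
      with \<open>g x \<in> ?I\<close> show "x \<in> (\<Union>t\<in>?I. B t)" by blast
    qed
  qed (use B_subset in blast)
  have "increasing_borel_family ?I r B"
    unfolding increasing_borel_family_def
  proof (intro conjI ballI monotone_onI)
    show "B t \<in> sets borel" if "t \<in> ?I" for t
      using N_null[OF that] by (auto simp: B_def)
    fix s t assume st: "s \<in> ?I" "t \<in> ?I" "(s, t) \<in> r"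
    then have "m s \<le> m t" using assms(5) by (simp add: monotone_on_def)
    moreover have "N s \<subseteq> N t"
      using st(3) transD[OF trans] by (auto simp: N_def)
    ultimately show "B s \<subseteq> B t" by (auto simp: B_def)
  qed
  moreover have "emeasure lborel (B t) = ennreal (m t)" if "t \<in> ?I" for t
    using emeasure_Un_null_set[OF _ N_null[OF that], of "{0<..<m t}"] m_nonneg[OF that]
    by (simp add: B_def)
  ultimately show ?thesis
    using B_subset B_Un M_nonneg by (intro exI[of _ B]) auto
qed

end
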